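(* Fix $\alpha>0$ and real constants $C_1,C_2$ with $2C_1+C_2>0$. The functions $b_-$ and $b_+$ are $C^1$ and strictly increasing on $(0,C_{3,crit})$. $b_-$ increases from $b_-(0^+)=-\frac12C_1^2-C_1C_2$ to $b_-(C_{3,crit}^-)=\frac16(C_1-C_2)^2$. $b_+$ increases from $b_+(0^+)=\frac18(C_2^2-4C_1C_2)$ to $b_+(C_{3,crit}^-)=\frac16(C_1-C_2)^2$. Denote by $C_3^-(b)$ and $C_3^+(b)$ the ($C^1$) inverses of $b_-$ and $b_+$. For every $(C_3,b)$ in the open, simply connected region $$\{(C_3,b):\ 0<C_3<C_{3,crit},\ b_-(C_3)<b<b_+(C_3)\}$$ there exists a smooth periodic solution $\phi\in H^\infty_{per}$ of (E1)–(E2). This region is the region of the $(C_3,b)$-plane enclosed by the three boundaries: (1) $C_3=0$, $b\in\big(-\frac{C_1^2}{2}-C_1C_2,\ \frac18(C_2^2-4C_1C_2)\big)$; (2) $C_3=C_3^+(b)$, $b\in\big(\frac18(C_2^2-4C_1C_2),\ \frac16(C_1-C_2)^2\big)$; (3) $C_3=C_3^-(b)$, $b\in\big(-\frac12C_1^2-C_1C_2,\ \frac16(C_1-C_2)^2\big)$.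
   Context: Let $\alpha>0$ and $\omega,\gamma,c\in\mathbb R$. Consider the Dullin–Gottwald–Holm (DGH) equation $m_t+2\omega u_x+um_x+2mu_x+\gamma u_{xxx}=0$ with $m=u-\alpha^2u_{xx}$. Travelling waves have the form $u(x,t)=\phi(\xi)$ with $\xi=x-ct$. Set $C_1=c+\gamma/\alpha^2$ and $C_2=2\omega+\gamma/\alpha^2$. Travelling wave profiles satisfy, for real constants $b$ and $C_3$, (E1) $\alpha^2(\phi-C_1)\phi''+\frac12\alpha^2(\phi')^2+(C_1-C_2-\frac32\phi)\phi=b$, together with the first integral (E2) $\alpha^2(\phi-C_1)(\phi')^2+(C_1-C_2)\phi^2-\phi^3-2b\phi+C_1(2b+C_1C_2)=C_3$. Let $C_{3,crit}=\frac1{27}(2C_1+C_2)^3$. For $C_3\in(0,C_{3,crit})$, the equation $2(\phi-C_1)^2(\phi+\frac{C_2}{2})=C_3$ has three real roots $\phi_1<\phi_2<\phi_3$, ordered as $-\frac{C_2}{2}<\phi_1<\frac{C_1-C_2}{3}<\phi_2<C_1<\phi_3$. Define $U(\phi)=-\frac12\phi^2-\frac12C_2\phi-\frac12C_1C_2-\frac{C_3}{2(\phi-C_1)}$. With $z=\xi/\alpha$, (E2) becomes $b=\frac12(d\phi/dz)^2+U(\phi)$. Set $b_-(C_3)=U(\phi_2)$ and $b_+(C_3)=U(\phi_1)$. *)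

theory Defs
  imports "HOL-Analysis.Analysis"
begin

definition C3crit :: "real \<Rightarrow> real \<Rightarrow> real" where
  "C3crit C1 C2 = (2*C1 + C2)^3 / 27"

definition phi1 :: "real \<Rightarrow> real \<Rightarrow> real \<Rightarrow> real" where
  "phi1 C1 C2 C3 = (THE p. - C2/2 < p \<and> p < (C1 - C2)/3 \<and> 2*(p - C1)^2*(p + C2/2) = C3)"

definition phi2 :: "real \<Rightarrow> real \<Rightarrow> real \<Rightarrow> real" where
  "phi2 C1 C2 C3 = (THE p. (C1 - C2)/3 < p \<and> p < C1 \<and> 2*(p - C1)^2*(p + C2/2) = C3)"

definition U :: "real \<Rightarrow> real \<Rightarrow> real \<Rightarrow> real \<Rightarrow> real" where
  "U C1 C2 C3 p = - (1/2)*p^2 - (1/2)*C2*p - (1/2)*C1*C2 - C3 / (2*(p - C1))"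

definition b_minus :: "real \<Rightarrow> real \<Rightarrow> real \<Rightarrow> real" where
  "b_minus C1 C2 C3 = U C1 C2 C3 (phi2 C1 C2 C3)"

definition b_plus :: "real \<Rightarrow> real \<Rightarrow> real \<Rightarrow> real" where
  "b_plus C1 C2 C3 = U C1 C2 C3 (phi1 C1 C2 C3)"

definition C3_minus :: "real \<Rightarrow> real \<Rightarrow> real \<Rightarrow> real" where
  "C3_minus C1 C2 = inv_into {0<..<C3crit C1 C2} (b_minus C1 C2)"

definition C3_plus :: "real \<Rightarrow> real \<Rightarrow> real \<Rightarrow> real" where
  "C3_plus C1 C2 = inv_into {0<..<C3crit C1 C2} (b_plus C1 C2)"

definition region :: "real \<Rightarrow> real \<Rightarrow> (real \<times> real) set" where
  "region C1 C2 = {(C3, b). 0 < C3 \<and> C3 < C3crit C1 C2 \<and>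
                            b_minus C1 C2 C3 < b \<and> b < b_plus C1 C2 C3}"

definition C1_on :: "real set \<Rightarrow> (real \<Rightarrow> real) \<Rightarrow> bool" where
  "C1_on S f \<longleftrightarrow> (\<exists>f'. (\<forall>x\<in>S. (f has_real_derivative f' x) (at x)) \<and> continuous_on S f')"

definition smooth_fun :: "(real \<Rightarrow> real) \<Rightarrow> bool" where
  "smooth_fun f \<longleftrightarrow> (\<forall>k x. ((deriv ^^ k) f) differentiable (at x))"

definition periodic_fun :: "(real \<Rightarrow> real) \<Rightarrow> bool" where
  "periodic_fun f \<longleftrightarrow> (\<exists>L>0. \<forall>x. f (x + L) = f x)"

definition TW_solution :: "real \<Rightarrow> real \<Rightarrow> real \<Rightarrow> real \<Rightarrow> real \<Rightarrow> (real \<Rightarrow> real) \<Rightarrow> bool" where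
  "TW_solution \<alpha> C1 C2 b C3 \<phi> \<longleftrightarrow>
     (\<forall>\<xi>. \<alpha>^2 * (\<phi> \<xi> - C1) * deriv (deriv \<phi>) \<xi> + (1/2) * \<alpha>^2 * (deriv \<phi> \<xi>)^2
            + (C1 - C2 - (3/2) * \<phi> \<xi>) * \<phi> \<xi> = b)
   \<and> (\<forall>\<xi>. \<alpha>^2 * (\<phi> \<xi> - C1) * (deriv \<phi> \<xi>)^2 + (C1 - C2) * (\<phi> \<xi>)^2 - (\<phi> \<xi>)^3
            - 2*b*\<phi> \<xi> + C1 * (2*b + C1*C2) = C3)"

end

theory Submission
  imports Defs
begin

text \<open>Put \<open>h = (2 C1 + C2)/6\<close>, \<open>M = (C1 - C2)\<^sup>2/6\<close> and \<open>p = (C1 - C2)/3 + s\<close>. Then \<open>p\<close> is a critical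
  point of \<open>U\<close> iff \<open>C3 = 2 (s\<^sup>3 - 3 h s\<^sup>2 + 4 h\<^sup>3)\<close>, and its critical value is \<open>M - 3/2 s\<^sup>2\<close>. Solving
  \<open>b = M - 3/2 s\<^sup>2\<close> for \<open>s\<close> therefore gives the inverses of \<open>b_minus\<close> (\<open>s > 0\<close>) and \<open>b_plus\<close> (\<open>s < 0\<close>)
  in closed form, and all claims on these functions follow from the inverse function theorem in one
  variable. The region lies between two continuous graphs over an interval, hence is homeomorphic
  to a rectangle.

  In the region, (E2) reads \<open>\<alpha>\<^sup>2 (\<phi> - C1) (\<phi>')\<^sup>2 = (\<phi> - r0) (\<phi> - r1) (\<phi> - r2)\<close> with
  \<open>r0 < r1 < r2 < C1\<close>. The substitution \<open>\<phi> = (r1 + r2)/2 + (r2 - r1)/2 * cos \<theta>\<close> removes the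
  turning points: it becomes \<open>\<theta>' = sqrt ((\<phi> - r0)/(C1 - \<phi>))/\<alpha>\<close>, whose right-hand side is positive and
  \<open>2 \<pi>\<close>-periodic in \<open>\<theta>\<close>, so that a quadrature solves it. The solution is smooth because
  the polynomials in \<open>cos \<theta>\<close>, \<open>sin \<theta>\<close>, \<open>\<theta>'\<close> and \<open>1/(C1 - \<phi>)\<close> are closed under differentiation.\<close>

subsection \<open>Inverses of increasing functions\<close>

text \<open>\<open>G\<close> stands for an explicit branch and \<open>g\<close> for
  \<open>b_minus\<close> or \<open>b_plus\<close>; everything known about \<open>G\<close> is
  transferred to \<open>g\<close>. Continuity on the closed interval supplies the limits of
  \<open>g\<close>. The derivative conditions are confined to the interior because the derivative of
  the \<open>b_minus\<close> branch vanishes at \<open>l\<close>.\<close>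

locale increasing_branch =
  fixes G G' g :: "real \<Rightarrow> real" and l M :: real
  assumes less: "l < M"
    and cont: "continuous_on {l..M} G"
    and deriv: "\<And>x. x \<in> {l<..<M} \<Longrightarrow> (G has_real_derivative G' x) (at x)"
    and deriv_pos: "\<And>x. x \<in> {l<..<M} \<Longrightarrow> G' x > 0"
    and cont_deriv: "continuous_on {l<..<M} G'"
    and left_inverse: "\<And>x. x \<in> {l<..<M} \<Longrightarrow> g (G x) = x"
begin

lemma G_less: "G x < G y" if "l \<le> x" "x < y" "y \<le> M"
proof (rule DERIV_pos_imp_increasing_open[OF that(2)])
  show "\<exists>D. (G has_real_derivative D) (at z) \<and> 0 < D" if "x < z" "z < y" for z
    using that deriv[of z] deriv_pos[of z] \<open>l \<le> x\<close> \<open>y \<le> M\<close> by force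
  show "continuous_on {x..y} G"
    using cont by (rule continuous_on_subset) (use that in auto)
qed

lemma G_less_iff: "G x < G y \<longleftrightarrow> x < y" if "x \<in> {l..M}" "y \<in> {l..M}"
  using G_less[of x y] G_less[of y x] that by (cases x y rule: linorder_cases) auto

lemma G_in: "G x \<in> {G l<..<G M}" if "x \<in> {l<..<M}"
  using that G_less_iff[of l x] G_less_iff[of x M] by auto

text \<open>The intermediate value theorem gives a preimage under \<open>G\<close>, and the left
  inverse property identifies it with \<open>g y\<close>; so \<open>g\<close> is a right inverse
  too.\<close>

lemma inverse_obtains:
  assumes "y \<in> {G l<..<G M}"
  obtains x where "x \<in> {l<..<M}" "G x = y" "g y = x"
proof -
  obtain x where x: "l \<le> x" "x \<le> M" "G x = y"
    using IVT'[of G l y M] assms less cont by auto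
  with assms have "x \<in> {l<..<M}"
    by (auto simp: less_le)
  with x left_inverse that show thesis by blast
qed

lemma g_in: "y \<in> {G l<..<G M} \<Longrightarrow> g y \<in> {l<..<M}"
  by (erule inverse_obtains) simp

lemma right_inverse: "y \<in> {G l<..<G M} \<Longrightarrow> G (g y) = y"
  by (erule inverse_obtains) simp

lemma g_strict_mono: "strict_mono_on {G l<..<G M} g"
proof (rule strict_mono_onI)
  fix y z assume yz: "y \<in> {G l<..<G M}" "z \<in> {G l<..<G M}" "y < z"
  then have "G (g y) < G (g z)"
    by (simp add: right_inverse)
  then show "g y < g z"
    using G_less_iff[of "g y" "g z"] g_in[of y] g_in[of z] yz by auto
qed

text \<open>\<open>C3_minus\<close> and \<open>C3_plus\<close> are defined by
  \<open>inv_into\<close>; injectivity of \<open>g\<close> makes them coincide with the explicit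
  branches.\<close>

lemma inv_into_eq: "inv_into {G l<..<G M} g x = G x" if "x \<in> {l<..<M}"
  using inv_into_f_f[OF strict_mono_on_imp_inj_on[OF g_strict_mono] G_in[OF that]]
    left_inverse[OF that] by simp

lemma g_deriv: "(g has_real_derivative inverse (G' (g y))) (at y)" if y: "y \<in> {G l<..<G M}"
proof -
  obtain x where x: "x \<in> {l<..<M}" "G x = y" "g y = x"
    using y by (rule inverse_obtains)
  \<comment> \<open>A compact neighbourhood of \<open>x\<close> inside the open interval, where
    \<open>g\<close> is known to invert \<open>G\<close>, suffices for continuity of the
    inverse.\<close>
  obtain a b where ab: "l < a" "a < x" "x < b" "b < M"
    using x(1) by (meson dense greaterThanLessThan_iff)
  have "isCont g (G x)"
  proof (rule isCont_inverse_function2[OF ab(2,3)])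
    fix z assume "a \<le> z" "z \<le> b"
    then have "z \<in> {l<..<M}" using ab by auto
    then show "g (G z) = z" "isCont G z"
      using left_inverse DERIV_isCont[OF deriv] by auto
  qed
  moreover have "(G has_real_derivative G' (g y)) (at (g y))" "G' (g y) \<noteq> 0"
    using deriv[OF x(1)] deriv_pos[OF x(1)] x(3) by auto
  ultimately show ?thesis
    using y x by (intro DERIV_inverse_function[where f=G and a="G l" and b="G M"])
      (auto intro: right_inverse)
qed

lemma C1_on_g: "C1_on {G l<..<G M} g"
  unfolding C1_on_def
proof (intro exI[of _ "\<lambda>y. inverse (G' (g y))"] conjI ballI g_deriv)
  have "continuous_on {G l<..<G M} g"
    using g_deriv by (meson DERIV_isCont continuous_at_imp_continuous_on)
  then have "continuous_on {G l<..<G M} (\<lambda>y. G' (g y))"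
    by (rule continuous_on_compose2[OF cont_deriv]) (use g_in in blast)
  then show "continuous_on {G l<..<G M} (\<lambda>y. inverse (G' (g y)))"
    by (rule continuous_on_inverse) (use g_in deriv_pos in force)
qed

lemma C1_on_inv_into: "C1_on {l<..<M} (inv_into {G l<..<G M} g)"
  unfolding C1_on_def
proof (intro exI[of _ G'] conjI ballI cont_deriv)
  fix x assume x: "x \<in> {l<..<M}"
  show "(inv_into {G l<..<G M} g has_real_derivative G' x) (at x)"
    by (rule has_field_derivative_transform_within_open[OF deriv[OF x], of "{l<..<M}"])
      (use x inv_into_eq in auto)
qed

lemma less_g_iff: "x < g y \<longleftrightarrow> G x < y" if "x \<in> {l..M}" "y \<in> {G l<..<G M}"
  using G_less_iff[of x "g y"] g_in[OF that(2)] right_inverse[OF that(2)] that(1) by auto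

lemma g_less_iff: "g y < x \<longleftrightarrow> y < G x" if "x \<in> {l..M}" "y \<in> {G l<..<G M}"
  using G_less_iff[of "g y" x] g_in[OF that(2)] right_inverse[OF that(2)] that(1) by auto

lemma tendsto_left_end: "(g \<longlongrightarrow> l) (at_right (G l))"
proof (rule order_tendstoI)
  have *: "eventually (\<lambda>y. y \<in> {G l<..<G x}) (at_right (G l))" if "x \<in> {l<..M}" for x
    using that G_less[of l x] eventually_at_right_real by auto
  show "eventually (\<lambda>y. a < g y) (at_right (G l))" if "a < l" for a
    by (rule eventually_mono[OF *[of M]]) (use less that g_in in force)+
  show "eventually (\<lambda>y. g y < a) (at_right (G l))" if "l < a" for a
  proof -
    \<comment> \<open>Truncation at \<open>M\<close> keeps the comparison point in the interval
      where \<open>G\<close> is controlled; \<open>a\<close> may lie beyond it.\<close>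
    have x: "min a M \<in> {l<..M}" using that less by auto
    have "G (min a M) \<le> G M" using G_less_iff[of M "min a M"] x by auto
    show ?thesis
      using *[OF x]
    proof eventually_elim
      case (elim y)
      then have "g y < min a M"
        using g_less_iff[of "min a M" y] x \<open>G (min a M) \<le> G M\<close> by auto
      then show ?case by simp
    qed
  qed
qed

lemma tendsto_right_end: "(g \<longlongrightarrow> M) (at_left (G M))"
proof (rule order_tendstoI)
  have *: "eventually (\<lambda>y. y \<in> {G x<..<G M}) (at_left (G M))" if "x \<in> {l..<M}" for x
    using that G_less[of x M] eventually_at_left_real by auto
  show "eventually (\<lambda>y. g y < a) (at_left (G M))" if "a > M" for a
    by (rule eventually_mono[OF *[of l]]) (use less that g_in in force)+
  show "eventually (\<lambda>y. a < g y) (at_left (G M))" if "a < M" for a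
  proof -
    have x: "max a l \<in> {l..<M}" using that less by auto
    have "G l \<le> G (max a l)" using G_less_iff[of "max a l" l] x by auto
    show ?thesis
      using *[OF x]
    proof eventually_elim
      case (elim y)
      then have "max a l < g y"
        using less_g_iff[of "max a l" y] x \<open>G l \<le> G (max a l)\<close> by auto
      then show ?case by simp
    qed
  qed
qed

end

subsection \<open>The critical values of the potential\<close>

text \<open>\<open>\<sigma> = 1\<close> gives the inverse of \<open>b_minus\<close>, \<open>\<sigma> = -1\<close> the inverse of \<open>b_plus\<close>.\<close>

definition branch :: "real \<Rightarrow> real \<Rightarrow> real \<Rightarrow> real \<Rightarrow> real" where
  "branch h M \<sigma> b = (let r = sqrt (2/3 * (M - b)) in 2 * (\<sigma> * r^3 - 3 * h * r^2 + 4 * h^3))"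

lemma branch_eq:
  "r \<ge> 0 \<Longrightarrow> branch h M \<sigma> (M - 3/2 * r^2) = 2 * (\<sigma> * r^3 - 3 * h * r^2 + 4 * h^3)"
  by (simp add: branch_def Let_def)

text \<open>\<open>r\<close> is the distance of the critical point of \<open>U\<close> from
  \<open>(C1 - C2)/3\<close>, where \<open>phi1\<close> and \<open>phi2\<close> merge as
  \<open>C3\<close> reaches \<open>C3crit\<close>.\<close>

lemma amplitude_obtains:
  fixes b M \<rho> :: real
  assumes "b \<in> {M - 3/2 * \<rho>^2<..<M}" "\<rho> > 0"
  obtains r where "0 < r" "r < \<rho>" "b = M - 3/2 * r^2" "r = sqrt (2/3 * (M - b))"
proof -
  define r where "r = sqrt (2/3 * (M - b))"
  have r: "r^2 = 2/3 * (M - b)" "r > 0"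
    using assms by (auto simp: r_def)
  then have b: "b = M - 3/2 * r^2" by auto
  have "r^2 < \<rho>^2" using assms(1) unfolding r(1) by auto
  then have "r < \<rho>" using assms(2) by (simp add: power_less_imp_less_base)
  then show thesis using r(2) b r_def by (intro that)
qed

text \<open>By the chain rule the derivative in \<open>b\<close> is
  \<open>2 * (3 * \<sigma> * r^2 - 6 * h * r)\<close> divided by \<open>- 3 * r\<close>. The factor
  \<open>r\<close> cancels, so the singularity of the square root at \<open>b = M\<close>
  disappears.\<close>

lemma branch_increasing:
  assumes "\<rho> > 0" "\<And>r. 0 < r \<Longrightarrow> r < \<rho> \<Longrightarrow> \<sigma> * r < 2 * h"
    and inv: "\<And>r. 0 < r \<Longrightarrow> r < \<rho> \<Longrightarrow>
      g (2 * (\<sigma> * r^3 - 3 * h * r^2 + 4 * h^3)) = M - 3/2 * r^2"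
  shows "increasing_branch (branch h M \<sigma>) (\<lambda>b. 2 * (2 * h - \<sigma> * sqrt (2/3 * (M - b)))) g
           (M - 3/2 * \<rho>^2) M"
proof
  show "M - 3/2 * \<rho>^2 < M" using assms(1) by simp
  show "continuous_on {M - 3/2 * \<rho>^2..M} (branch h M \<sigma>)"
    unfolding branch_def Let_def by (intro continuous_intros)
  show "continuous_on {M - 3/2 * \<rho>^2<..<M} (\<lambda>b. 2 * (2 * h - \<sigma> * sqrt (2/3 * (M - b))))"
    by (intro continuous_intros)
next
  fix b assume b: "b \<in> {M - 3/2 * \<rho>^2<..<M}"
  obtain r where r: "0 < r" "r < \<rho>" "b = M - 3/2 * r^2" and r_def: "r = sqrt (2/3 * (M - b))"
    using b assms(1) by (rule amplitude_obtains)
  with assms(2) show "2 * (2 * h - \<sigma> * sqrt (2/3 * (M - b))) > 0"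
    unfolding r_def[symmetric] by simp
  show "g (branch h M \<sigma> b) = b"
    using inv[OF r(1,2)] r branch_eq[of r h M \<sigma>] by simp
  show "(branch h M \<sigma> has_real_derivative 2 * (2 * h - \<sigma> * sqrt (2/3 * (M - b)))) (at b)"
    unfolding branch_def Let_def
    apply (rule derivative_eq_intros refl | use b in simp; fail)+
    unfolding r_def[symmetric] using r(1)
    by (simp add: field_simps power2_eq_square power3_eq_cube)
qed

text \<open>The two values differ by \<open>4 * r^3\<close>.\<close>

lemma branch_less: "branch h M (-1) b < branch h M 1 b" if "b < M"
proof -
  have "0 < (sqrt (2/3 * (M - b)))^3" using that by simp
  then show ?thesis by (simp add: branch_def Let_def)
qed

text \<open>In the shifted variable the factors are \<open>s - 2 * h\<close> and
  \<open>s + h\<close>. The shift moves a critical point of the cubic to 0, so no linear term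
  remains.\<close>

lemma cubic_shift:
  fixes C1 C2 s h :: real
  assumes "h = (2 * C1 + C2)/6"
  shows "2 * ((C1 - C2)/3 + s - C1)^2 * ((C1 - C2)/3 + s + C2/2)
    = 2 * (s^3 - 3 * h * s^2 + 4 * h^3)"
  unfolding assms by (simp add: field_simps power2_eq_square power3_eq_cube)

text \<open>\<open>s = 2 * h\<close> is the pole \<open>p = C1\<close>. Away from it the singular
  quotient in \<open>U\<close> reduces to \<open>(s - 2 * h) * (s + h)\<close>.\<close>

lemma U_critical:
  fixes C1 C2 s h :: real
  assumes "h = (2 * C1 + C2)/6" "s \<noteq> 2 * h"
  shows "U C1 C2 (2 * (s^3 - 3 * h * s^2 + 4 * h^3)) ((C1 - C2)/3 + s)
    = (C1 - C2)^2/6 - 3/2 * s^2"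
proof -
  have *: "(C1 - C2)/3 + s - C1 = s - 2 * h" using assms by (simp add: field_simps)
  have "2 * (s^3 - 3 * h * s^2 + 4 * h^3) = 2 * (s - 2 * h) * ((s - 2 * h) * (s + h))"
    by (simp add: algebra_simps power2_eq_square power3_eq_cube)
  then have quot: "2 * (s^3 - 3 * h * s^2 + 4 * h^3) / (2 * (s - 2 * h)) = (s - 2 * h) * (s + h)"
    using assms(2) by simp
  show ?thesis
    unfolding U_def * quot unfolding assms(1) by (simp add: field_simps power2_eq_square)
qed

section \<open>Uniqueness and explicit form of the critical points\<close>

lemma reduced_cubic_inj_pos:
  fixes u v h :: real
  assumes eq: "u^3 - 3 * h * u^2 = v^3 - 3 * h * v^2"
    and "0 < u" "u < 2 * h" "0 < v" "v < 2 * h"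
  shows "u = v"
proof -
  \<comment> \<open>The first two products plus half the sum of the last two give the negative of
    the cofactor of \<open>u - v\<close>.\<close>
  have "u * (2 * h - u) > 0" "v * (2 * h - v) > 0" "u * (2 * h - v) > 0" "v * (2 * h - u) > 0"
    using assms by auto
  then have "u * u + u * v + v * v - 3 * h * (u + v) \<noteq> 0"
    by (simp add: algebra_simps)
  moreover have "(u - v) * (u * u + u * v + v * v - 3 * h * (u + v)) = 0"
    using eq by (simp add: algebra_simps power2_eq_square power3_eq_cube)
  ultimately show ?thesis by simp
qed

lemma reduced_cubic_inj_neg:
  fixes u v h :: real
  assumes eq: "u^3 - 3 * h * u^2 = v^3 - 3 * h * v^2" and "0 < h" "u < 0" "v < 0"
  shows "u = v"
proof -
  have "u * u > 0" "v * v > 0" "u * v > 0" "h * (u + v) < 0"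
    using assms by (auto simp: mult_pos_neg mult_neg_neg)
  then have "u * u + u * v + v * v - 3 * h * (u + v) \<noteq> 0"
    by (simp add: algebra_simps)
  moreover have "(u - v) * (u * u + u * v + v * v - 3 * h * (u + v)) = 0"
    using eq by (simp add: algebra_simps power2_eq_square power3_eq_cube)
  ultimately show ?thesis by simp
qed

lemma phi2_eq:
  assumes h: "h = (2 * C1 + C2)/6" and s: "0 < s" "s < 2 * h"
  shows "phi2 C1 C2 (2 * (s^3 - 3 * h * s^2 + 4 * h^3)) = (C1 - C2)/3 + s"
  unfolding phi2_def
proof (rule the_equality)
  show "(C1 - C2)/3 < (C1 - C2)/3 + s \<and> (C1 - C2)/3 + s < C1 \<and>
    2 * ((C1 - C2)/3 + s - C1)^2 * ((C1 - C2)/3 + s + C2/2) = 2 * (s^3 - 3 * h * s^2 + 4 * h^3)"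
    by (intro conjI cubic_shift[OF h]) (use s h in \<open>simp_all add: field_simps\<close>)
next
  fix p assume p: "(C1 - C2)/3 < p \<and> p < C1 \<and>
    2 * (p - C1)^2 * (p + C2/2) = 2 * (s^3 - 3 * h * s^2 + 4 * h^3)"
  define u where "u = p - (C1 - C2)/3"
  have "p = (C1 - C2)/3 + u" by (simp add: u_def)
  with p cubic_shift[OF h, of u] have "u^3 - 3 * h * u^2 = s^3 - 3 * h * s^2" by simp
  moreover have "(C1 - C2)/3 < p" "p < C1" using p by auto
  then have "0 < u" "u < 2 * h" using h by (auto simp: u_def field_simps)
  ultimately have "u = s" using reduced_cubic_inj_pos s by blast
  then show "p = (C1 - C2)/3 + s" by (simp add: u_def)
qed

lemma phi1_eq:
  assumes h: "h = (2 * C1 + C2)/6" and s: "- h < s" "s < 0"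
  shows "phi1 C1 C2 (2 * (s^3 - 3 * h * s^2 + 4 * h^3)) = (C1 - C2)/3 + s"
  unfolding phi1_def
proof (rule the_equality)
  show "- C2/2 < (C1 - C2)/3 + s \<and> (C1 - C2)/3 + s < (C1 - C2)/3 \<and>
    2 * ((C1 - C2)/3 + s - C1)^2 * ((C1 - C2)/3 + s + C2/2) = 2 * (s^3 - 3 * h * s^2 + 4 * h^3)"
    by (intro conjI cubic_shift[OF h]) (use s h in \<open>simp_all add: field_simps\<close>)
next
  fix p assume p: "- C2/2 < p \<and> p < (C1 - C2)/3 \<and>
    2 * (p - C1)^2 * (p + C2/2) = 2 * (s^3 - 3 * h * s^2 + 4 * h^3)"
  define u where "u = p - (C1 - C2)/3"
  have "p = (C1 - C2)/3 + u" by (simp add: u_def)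
  with p cubic_shift[OF h, of u] have "u^3 - 3 * h * u^2 = s^3 - 3 * h * s^2" by simp
  moreover have "u < 0" "h > 0" using p s h by (auto simp: u_def)
  ultimately have "u = s" using reduced_cubic_inj_neg s by blast
  then show "p = (C1 - C2)/3 + s" by (simp add: u_def)
qed

text \<open>The range of \<open>r\<close> ends at \<open>2 * h\<close>, the distance from
  \<open>(C1 - C2)/3\<close> to \<open>C1\<close>.\<close>

lemma b_minus_branch:
  assumes h: "h = (2 * C1 + C2)/6" "h > 0" and M: "M = (C1 - C2)^2/6"
  shows "increasing_branch (branch h M 1) (\<lambda>b. 2 * (2 * h - 1 * sqrt (2/3 * (M - b))))
           (b_minus C1 C2) (M - 3/2 * (2 * h)^2) M"
proof (rule branch_increasing)
  fix r :: real assume r: "0 < r" "r < 2 * h"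
  show "1 * r < 2 * h" using r by simp
  show "b_minus C1 C2 (2 * (1 * r^3 - 3 * h * r^2 + 4 * h^3)) = M - 3/2 * r^2"
    using phi2_eq[OF h(1) r] U_critical[OF h(1), of r] r unfolding b_minus_def M by simp
qed (use h in auto)

text \<open>Here \<open>s = - r\<close>, which flips the sign of the cubic term, and
  \<open>r\<close> ends at \<open>h\<close>, the distance from \<open>- C2/2\<close> to
  \<open>(C1 - C2)/3\<close>.\<close>

lemma b_plus_branch:
  assumes h: "h = (2 * C1 + C2)/6" "h > 0" and M: "M = (C1 - C2)^2/6"
  shows "increasing_branch (branch h M (-1)) (\<lambda>b. 2 * (2 * h - (-1) * sqrt (2/3 * (M - b))))
           (b_plus C1 C2) (M - 3/2 * h^2) M"
proof (rule branch_increasing)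
  fix r :: real assume r: "0 < r" "r < h"
  show "-1 * r < 2 * h" using r by simp
  show "b_plus C1 C2 (2 * (-1 * r^3 - 3 * h * r^2 + 4 * h^3)) = M - 3/2 * r^2"
    using phi1_eq[OF h(1), of "-r"] U_critical[OF h(1), of "-r"] r unfolding b_plus_def M by simp
qed (use h in auto)

subsection \<open>Domains between two graphs\<close>

text \<open>Rescaling each vertical fibre affinely to the unit interval gives a homeomorphism with a
  convex product.\<close>

lemma simply_connected_between_graphs:
  fixes f g :: "real \<Rightarrow> real"
  assumes "continuous_on I f" "continuous_on I g" "convex I" "\<And>x. x \<in> I \<Longrightarrow> f x < g x"
  shows "simply_connected {(x, y). x \<in> I \<and> f x < y \<and> y < g x}" (is "simply_connected ?R")
proof -
  let ?t = "\<lambda>(x, t). (x, f x + t * (g x - f x))"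
  let ?s = "\<lambda>(x, y). (x, (y - f x) / (g x - f x))"
  have c: "continuous_on S (\<lambda>p. f (fst p))" "continuous_on S (\<lambda>p. g (fst p))"
    if "S \<subseteq> I \<times> UNIV" for S :: "(real \<times> real) set"
    using that by (auto intro!: continuous_intros
        continuous_on_compose2[OF assms(1)] continuous_on_compose2[OF assms(2)])
  have "homeomorphism (I \<times> {0<..<1}) ?R ?t ?s"
    unfolding homeomorphism_def
  proof (intro conjI ballI)
    show s: "?s (?t p) = p" if p_in: "p \<in> I \<times> {0<..<1}" for p
    proof -
      obtain x t where "p = (x, t)" "x \<in> I" using p_in by auto
      then show ?thesis using assms(4)[of x] by simp
    qed
    show t: "?t (?s p) = p" if p_in: "p \<in> ?R" for p
    proof -
      obtain x y where "p = (x, y)" "x \<in> I" using p_in by auto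
      then show ?thesis using assms(4)[of x] by simp
    qed
    have t': "?t p \<in> ?R" if p_in: "p \<in> I \<times> {0<..<1}" for p
    proof -
      obtain x t where p: "p = (x, t)" "x \<in> I" "0 < t" "t < 1" using p_in by auto
      have "0 < t * (g x - f x)" "0 < (1 - t) * (g x - f x)" using p assms(4) by auto
      then show ?thesis using p by (simp add: algebra_simps)
    qed
    have s': "?s p \<in> I \<times> {0<..<1}" if p_in: "p \<in> ?R" for p
    proof -
      obtain x y where "p = (x, y)" "x \<in> I" "f x < y" "y < g x" using p_in by auto
      then show ?thesis by simp
    qed
    show "?t ` (I \<times> {0<..<1}) = ?R"
    proof (intro equalityI image_subsetI t' subsetI)
      fix p assume p: "p \<in> ?R"
      show "p \<in> ?t ` (I \<times> {0<..<1})"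
        by (rule image_eqI[where f = ?t and x = "?s p", OF t[OF p, symmetric] s'[OF p]])
    qed
    show "?s ` ?R = I \<times> {0<..<1}"
    proof (intro equalityI image_subsetI s' subsetI)
      fix p assume p: "p \<in> I \<times> {0<..<1::real}"
      show "p \<in> ?s ` ?R"
        by (rule image_eqI[where f = ?s and x = "?t p", OF s[OF p, symmetric] t'[OF p]])
    qed
    have "continuous_on (I \<times> {0<..<1}) (\<lambda>p. (fst p, f (fst p) + snd p * (g (fst p) - f (fst p))))"
      by (intro continuous_intros c) auto
    then show "continuous_on (I \<times> {0<..<1}) ?t"
      by (simp only: case_prod_unfold)
    have "continuous_on ?R (\<lambda>p. (fst p, (snd p - f (fst p)) / (g (fst p) - f (fst p))))"
    proof (intro continuous_intros c)
      show "\<forall>p\<in>?R. g (fst p) - f (fst p) \<noteq> 0"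
        using assms(4) by (auto dest: less_imp_neq)
    qed auto
    then show "continuous_on ?R ?s"
      by (simp only: case_prod_unfold)
  qed
  then have "(I \<times> {0<..<1::real}) homeomorphic ?R"
    unfolding homeomorphic_def by blast
  moreover have "simply_connected (I \<times> {0<..<1::real})"
    using assms(3) by (intro convex_imp_simply_connected convex_Times) auto
  ultimately show ?thesis by (rule homeomorphic_simply_connected)
qed

lemma open_between_graphs:
  fixes f g :: "real \<Rightarrow> real"
  assumes "continuous_on I f" "continuous_on I g" "open I"
  shows "open {(x, y). x \<in> I \<and> f x < y \<and> y < g x}"
proof -
  have c: "continuous_on (I \<times> UNIV) (\<lambda>p. snd p - f (fst p))"
    "continuous_on (I \<times> UNIV) (\<lambda>p::real\<times>real. g (fst p) - snd p)"
    by (auto intro!: continuous_intros continuous_on_compose2[OF assms(1)] continuous_on_compose2[OF assms(2)])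
  have o: "open (I \<times> (UNIV::real set))" using assms(3) by (simp add: open_Times)
  have "open ((\<lambda>p. snd p - f (fst p)) -` {0<..} \<inter> (I \<times> UNIV))"
    "open ((\<lambda>p::real\<times>real. g (fst p) - snd p) -` {0<..} \<inter> (I \<times> UNIV))"
    using c unfolding continuous_on_open_vimage[OF o] by (auto simp only: open_greaterThan)
  then have "open (((\<lambda>p. snd p - f (fst p)) -` {0<..} \<inter> (I \<times> UNIV)) \<inter>
     ((\<lambda>p::real\<times>real. g (fst p) - snd p) -` {0<..} \<inter> (I \<times> UNIV)))"
    by (rule open_Int)
  also have "\<dots> = {(x, y). x \<in> I \<and> f x < y \<and> y < g x}" by auto
  finally show ?thesis .
qed

subsection \<open>Periodic solutions\<close>

text \<open>\<open>\<theta>\<close> is the inverse of the travel time \<open>T\<close>, the integral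
  of \<open>1/g\<close>. Positivity of \<open>g\<close> makes \<open>T\<close> increasing, and its
  periodicity makes \<open>T\<close> gain the same amount \<open>L\<close> over each period
  \<open>P\<close>; hence \<open>T\<close> is onto and \<open>L\<close> is the time of one
  turn.\<close>

lemma periodic_quadrature:
  fixes g :: "real \<Rightarrow> real"
  assumes "continuous_on UNIV g" "\<And>x. g x > 0" "P > 0" "\<And>x. g (x + P) = g x"
  obtains \<theta> L where "L > 0" "\<And>x. (\<theta> has_real_derivative g (\<theta> x)) (at x)"
    "\<And>x. \<theta> (x + L) = \<theta> x + P" "surj \<theta>"
proof -
  define T where "T = (\<lambda>x. LBINT y=ereal 0..ereal x. inverse (g y))"
  have T: "(T has_real_derivative inverse (g x)) (at x)" for x
  proof -
    have "continuous_on {- \<bar>x\<bar> - 1..\<bar>x\<bar> + 1} (\<lambda>y. inverse (g y))"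
      using assms(1,2) by (intro continuous_on_inverse continuous_on_subset[OF assms(1)])
        (auto simp: less_imp_neq[symmetric])
    then have "(T has_vector_derivative inverse (g x)) (at x within {- \<bar>x\<bar> - 1..\<bar>x\<bar> + 1})"
      unfolding T_def by (intro interval_integral_FTC2) auto
    then show ?thesis
      by (subst (asm) at_within_Icc_at) (auto simp: has_real_derivative_iff_has_vector_derivative)
  qed
  have T_less: "T x < T y" if "x < y" for x y
    using that by (rule DERIV_pos_imp_increasing) (use T assms(2) in \<open>auto intro!: exI[of _ "inverse (g _)"]\<close>)
  define L where "L = T P - T 0"
  have L: "L > 0" using T_less[OF assms(3)] by (simp add: L_def)
  have T_add: "T (x + P) = T x + L" for x
  proof -
    have "((\<lambda>x. T (x + P) - T x) has_real_derivative 0) (at x)" for x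
      using DERIV_diff[OF T[of "x + P", unfolded DERIV_shift] T[of x]] assms(4) by simp
    then have "T (x + P) - T x = T (0 + P) - T 0"
      using DERIV_isconst_all[of "\<lambda>x. T (x + P) - T x" x 0] by simp
    then show ?thesis by (simp add: L_def)
  qed
  have T_mult: "T (x + real n * P) = T x + real n * L" for x n
  proof (induction n)
    case (Suc n)
    then show ?case using T_add[of "x + real n * P"] by (simp add: algebra_simps)
  qed simp
  have "\<exists>x. T x = y" for y
  proof -
    \<comment> \<open>Enough full periods in both directions bracket \<open>y\<close> between two
      values of \<open>T\<close>.\<close>
    obtain n where n: "\<bar>y - T 0\<bar> < real n * L" using reals_Archimedean3[OF L] by blast
    then have "- (real n * L) < y - T 0" "y - T 0 < real n * L" by (simp_all only: abs_less_iff) linarith+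
    then have "T (- (real n * P)) \<le> y" "y \<le> T (real n * P)"
      using T_mult[of 0 n] T_mult[of "- (real n * P)" n] by simp_all
    then show ?thesis
      using IVT[of T "- (real n * P)" y "real n * P"] T assms(3) by (auto intro: DERIV_isCont)
  qed
  then have "surj T" by (metis surjI)
  moreover have "inj T" using T_less by (metis injI less_irrefl linorder_neqE)
  ultimately have bij: "bij T" by (simp add: bij_def)
  define \<theta> where "\<theta> = inv T"
  have \<theta>T: "\<theta> (T x) = x" and T\<theta>: "T (\<theta> x) = x" for x
    using bij unfolding \<theta>_def by (simp_all add: bij_is_inj bij_is_surj surj_f_inv_f)
  show thesis
  proof
    show "L > 0" by (rule L)
    show "surj \<theta>" using \<theta>T by (metis surjI)
    show "\<theta> (x + L) = \<theta> x + P" for x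
      by (metis T_add T\<theta> \<theta>T)
    show "(\<theta> has_real_derivative g (\<theta> x)) (at x)" for x
    proof -
      have "isCont \<theta> (T (\<theta> x))"
        by (rule isCont_inverse_function[of 1]) (use \<theta>T T in \<open>auto intro: DERIV_isCont\<close>)
      then have "(\<theta> has_real_derivative inverse (inverse (g (\<theta> x)))) (at x)"
        using T[of "\<theta> x"] assms(2)[of "\<theta> x"] T\<theta>
        by (intro DERIV_inverse_function[where f = T and g = \<theta> and a = "x - 1" and b = "x + 1"]) auto
      then show ?thesis by simp
    qed
  qed
qed

section \<open>Smoothness from closure under differentiation\<close>

lemma smooth_fun_closed:
  assumes "f \<in> S" "\<And>f. f \<in> S \<Longrightarrow> \<exists>f'\<in>S. \<forall>x. (f has_real_derivative f' x) (at x)"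
  shows "smooth_fun f"
proof -
  have "(deriv ^^ k) f \<in> S" for k
  proof (induction k)
    case (Suc k)
    then obtain f' where "f' \<in> S" "\<forall>x. ((deriv ^^ k) f has_real_derivative f' x) (at x)"
      using assms(2) by blast
    moreover from this have "deriv ((deriv ^^ k) f) = f'" by (auto intro: DERIV_imp_deriv)
    ultimately show ?case by simp
  qed (simp add: assms(1))
  then show ?thesis
    unfolding smooth_fun_def real_differentiable_def using assms(2) by blast
qed

inductive_set poly_closure :: "(real \<Rightarrow> real) set \<Rightarrow> (real \<Rightarrow> real) set" for B where
  base: "f \<in> B \<Longrightarrow> f \<in> poly_closure B"
| const: "(\<lambda>_. k) \<in> poly_closure B"
| add: "f \<in> poly_closure B \<Longrightarrow> g \<in> poly_closure B \<Longrightarrow> (\<lambda>x. f x + g x) \<in> poly_closure B"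
| mult: "f \<in> poly_closure B \<Longrightarrow> g \<in> poly_closure B \<Longrightarrow> (\<lambda>x. f x * g x) \<in> poly_closure B"

text \<open>By the sum and product rules, only the derivatives of the generators need to be
  checked.\<close>

lemma poly_closure_smooth:
  assumes "\<And>f. f \<in> B \<Longrightarrow> \<exists>f'\<in>poly_closure B. \<forall>x. (f has_real_derivative f' x) (at x)"
    and "f \<in> poly_closure B"
  shows "smooth_fun f"
proof (rule smooth_fun_closed[OF assms(2)])
  fix f assume "f \<in> poly_closure B"
  then show "\<exists>f'\<in>poly_closure B. \<forall>x. (f has_real_derivative f' x) (at x)"
  proof induction
    case (base f)
    then show ?case by (rule assms(1))
  next
    case (const k)
    show ?case by (rule bexI[of _ "\<lambda>_. 0"]) (auto intro: poly_closure.const)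
  next
    case (add f g)
    then obtain f' g' where "f' \<in> poly_closure B" "g' \<in> poly_closure B"
      "\<forall>x. (f has_real_derivative f' x) (at x)" "\<forall>x. (g has_real_derivative g' x) (at x)" by blast
    then show ?case
      by (intro bexI[of _ "\<lambda>x. f' x + g' x"]) (auto intro: poly_closure.intros DERIV_add)
  next
    case (mult f g)
    then obtain f' g' where "f' \<in> poly_closure B" "g' \<in> poly_closure B"
      "\<forall>x. (f has_real_derivative f' x) (at x)" "\<forall>x. (g has_real_derivative g' x) (at x)" by blast
    with mult.hyps show ?case
      by (intro bexI[of _ "\<lambda>x. f' x * g x + g' x * f x"]) (auto intro: poly_closure.intros DERIV_mult)
  qed
qed

text \<open>\<open>m\<close> and \<open>a\<close> are the midpoint and half distance of the two
  upper roots. Since \<open>(\<phi> - m)^2 - a^2\<close> equals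
  \<open>- (a * sin \<theta>)^2\<close>, (E2) amounts to the equation for \<open>\<theta>\<close>.
  (E1) is verified by direct computation, as dividing the differentiated (E2) by the derivative of
  \<open>\<phi>\<close> fails at turning points.\<close>

lemma TW_solution_of_roots:
  fixes \<alpha> C1 C2 b C3 m a r0 :: real
  assumes \<alpha>: "\<alpha> > 0" and a: "a > 0" and r0: "r0 < m - a" and C1: "m + a < C1"
    and R: "\<And>p. C3 - ((C1 - C2) * p^2 - p^3 - 2 * b * p + C1 * (2 * b + C1 * C2))
      = (p - r0) * ((p - m)^2 - a^2)"
  shows "\<exists>\<phi>. smooth_fun \<phi> \<and> periodic_fun \<phi> \<and> \<not> (\<exists>c. \<forall>\<xi>. \<phi> \<xi> = c) \<and> TW_solution \<alpha> C1 C2 b C3 \<phi>"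
proof -
  \<comment> \<open>As functions of the angle, \<open>A\<close> is \<open>\<phi> - r0\<close> and
    \<open>B\<close> is \<open>C1 - \<phi>\<close>; their sum is constant, which simplifies the
    derivative of \<open>A / B\<close>.\<close>
  define A where "A = (\<lambda>t. m + a * cos t - r0)"
  define B where "B = (\<lambda>t. C1 - (m + a * cos t))"
  have bnd: "\<bar>a * cos t\<bar> \<le> a" for t
    using a abs_cos_le_one[of t] by (simp add: abs_mult mult_left_le)
  have A: "A t > 0" and B: "B t > 0" for t
    using bnd[of t] r0 C1 by (auto simp: A_def B_def abs_le_iff)
  have AB: "A t + B t = C1 - r0" for t by (simp add: A_def B_def)
  define g where "g = (\<lambda>t. sqrt (A t / B t) / \<alpha>)"
  have g_pos: "g t > 0" for t using A[of t] B[of t] \<alpha> by (simp add: g_def)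
  have "continuous_on UNIV A" "continuous_on UNIV B"
    unfolding A_def B_def by (intro continuous_intros)+
  then have "continuous_on UNIV g"
    unfolding g_def using B \<alpha> by (intro continuous_intros) (auto simp: less_imp_neq[symmetric])
  moreover have "g (t + 2 * pi) = g t" for t
    by (simp add: g_def A_def B_def)
  ultimately obtain \<theta> L where L: "L > 0" and \<theta>: "\<And>x. (\<theta> has_real_derivative g (\<theta> x)) (at x)"
    and period: "\<And>x. \<theta> (x + L) = \<theta> x + 2 * pi" and "surj \<theta>"
    using periodic_quadrature[of g "2 * pi"] g_pos pi_gt_zero by (metis mult_pos_pos zero_less_numeral)
  define \<phi> c s w q where "\<phi> = (\<lambda>x. m + a * cos (\<theta> x))" and "c = (\<lambda>x. cos (\<theta> x))"
    and "s = (\<lambda>x. sin (\<theta> x))" and "w = (\<lambda>x. g (\<theta> x))" and "q = (\<lambda>x. inverse (B (\<theta> x)))"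
  have w2: "\<alpha>^2 * (w x)^2 = A (\<theta> x) / B (\<theta> x)" for x
    using \<alpha> A[of "\<theta> x"] B[of "\<theta> x"] by (simp add: w_def g_def power_divide)
  have dc: "(c has_real_derivative (-1) * (s x * w x)) (at x)" for x
    unfolding c_def s_def w_def by (auto intro!: derivative_eq_intros \<theta>)
  have ds: "(s has_real_derivative c x * w x) (at x)" for x
    unfolding c_def s_def w_def by (auto intro!: derivative_eq_intros \<theta>)
  have dB: "((\<lambda>x. B (\<theta> x)) has_real_derivative a * s x * w x) (at x)" for x
    unfolding B_def s_def w_def by (auto intro!: derivative_eq_intros \<theta>)
  have dA: "((\<lambda>x. A (\<theta> x)) has_real_derivative - (a * s x * w x)) (at x)" for x
    unfolding A_def s_def w_def by (auto intro!: derivative_eq_intros \<theta>)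
  have dq: "(q has_real_derivative (- a) * (s x * (w x * (q x * q x)))) (at x)" for x
  proof -
    have "B (\<theta> x) \<noteq> 0" using B[of "\<theta> x"] by simp
    then show ?thesis
      unfolding q_def by (auto intro!: derivative_eq_intros dB simp: field_simps)
  qed
  \<comment> \<open>Differentiating \<open>\<alpha>^2 * w^2 = A / B\<close> produces a factor
    \<open>w\<close> on both sides. Cancelling it leaves this constant times \<open>s * q^2\<close>,
    so \<open>1 / w\<close> need not be a generator.\<close>
  define k where "k = - (a * (C1 - r0)) / (2 * \<alpha>^2)"
  have dw: "(w has_real_derivative k * (s x * (q x * q x))) (at x)" for x
  proof -
    have pos: "A (\<theta> x) / B (\<theta> x) > 0" "B (\<theta> x) \<noteq> 0" using A[of "\<theta> x"] B[of "\<theta> x"] by auto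
    define D where "D = - (a * s x * w x) * (C1 - r0) / (B (\<theta> x) * B (\<theta> x))"
    have "((\<lambda>x. A (\<theta> x) / B (\<theta> x)) has_real_derivative
        ((- (a * s x * w x)) * B (\<theta> x) - A (\<theta> x) * (a * s x * w x)) / (B (\<theta> x) * B (\<theta> x))) (at x)"
      using pos by (intro DERIV_divide dA dB)
    moreover have "(- (a * s x * w x)) * B (\<theta> x) - A (\<theta> x) * (a * s x * w x) =
        - (a * s x * w x) * (C1 - r0)"
      unfolding AB[of "\<theta> x", symmetric] by (simp add: algebra_simps)
    ultimately have "((\<lambda>x. A (\<theta> x) / B (\<theta> x)) has_real_derivative D) (at x)"
      by (simp add: D_def)
    then have "((\<lambda>x. sqrt (A (\<theta> x) / B (\<theta> x)) / \<alpha>) has_real_derivative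
        (D * (inverse (sqrt (A (\<theta> x) / B (\<theta> x))) / 2)) / \<alpha>) (at x)"
      using DERIV_cdivide[OF DERIV_chain2[of sqrt _ "\<lambda>x. A (\<theta> x) / B (\<theta> x)", OF DERIV_real_sqrt[OF pos(1)]]]
      by (simp add: mult.commute)
    moreover have "sqrt (A (\<theta> x) / B (\<theta> x)) = \<alpha> * w x" using \<alpha> by (simp add: w_def g_def)
    moreover have "(D * (inverse (\<alpha> * w x) / 2)) / \<alpha> = k * (s x * (q x * q x))"
      using less_imp_neq[OF g_pos[of "\<theta> x"]] less_imp_neq[OF \<alpha>] pos(2) unfolding D_def k_def q_def w_def
      by (simp add: field_simps power2_eq_square)
    moreover have "(\<lambda>x. sqrt (A (\<theta> x) / B (\<theta> x)) / \<alpha>) = w" by (simp add: fun_eq_iff w_def g_def)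
    ultimately show ?thesis by (simp only:)
  qed
  have "smooth_fun (\<lambda>x. m + a * c x)"
  proof (rule poly_closure_smooth[of "{c, s, w, q}"])
    fix f assume "f \<in> {c, s, w, q}"
    then consider "f = c" | "f = s" | "f = w" | "f = q" by auto
    then show "\<exists>f'\<in>poly_closure {c, s, w, q}. \<forall>x. (f has_real_derivative f' x) (at x)"
    proof cases
      case 1
      show ?thesis
        unfolding 1 by (rule bexI, rule allI, rule dc) (intro poly_closure.intros; simp)
    next
      case 2
      show ?thesis
        unfolding 2 by (rule bexI, rule allI, rule ds) (intro poly_closure.intros; simp)
    next
      case 3
      show ?thesis
        unfolding 3 by (rule bexI, rule allI, rule dw) (intro poly_closure.intros; simp)
    next
      case 4
      show ?thesis
        unfolding 4 by (rule bexI, rule allI, rule dq) (intro poly_closure.intros; simp)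
    qed
  qed (intro poly_closure.intros; simp)
  then have "smooth_fun \<phi>" by (simp add: \<phi>_def c_def)
  moreover have "periodic_fun \<phi>"
    unfolding periodic_fun_def using L by (intro exI[of _ L]) (simp add: \<phi>_def period)
  moreover have "\<not> (\<exists>k. \<forall>x. \<phi> x = k)"
  proof
    assume "\<exists>k. \<forall>x. \<phi> x = k"
    then obtain k where k: "\<And>x. \<phi> x = k" by blast
    \<comment> \<open>At these angles \<open>\<phi>\<close> takes its extreme values
      \<open>m + a\<close> and \<open>m - a\<close>.\<close>
    obtain x y where "\<theta> x = 0" "\<theta> y = pi" using \<open>surj \<theta>\<close> by (metis surjD)
    then show False using k[of x] k[of y] a by (simp add: \<phi>_def)
  qed
  moreover have "TW_solution \<alpha> C1 C2 b C3 \<phi>"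
  proof -
    have d\<phi>: "(\<phi> has_real_derivative (- a) * (s x * w x)) (at x)" for x
      unfolding \<phi>_def using DERIV_add[OF DERIV_const DERIV_cmult[OF dc[unfolded c_def]]] by simp
    then have deriv1: "deriv \<phi> = (\<lambda>x. (- a) * (s x * w x))" by (auto intro: DERIV_imp_deriv)
    have "((\<lambda>x. (- a) * (s x * w x)) has_real_derivative
        (- a) * (c x * w x * w x + k * (s x * (q x * q x)) * s x)) (at x)" for x
      by (intro DERIV_cmult DERIV_mult ds dw)
    then have deriv2: "deriv (deriv \<phi>) x = (- a) * (c x * w x * w x + k * (s x * (q x * q x)) * s x)" for x
      unfolding deriv1 by (intro DERIV_imp_deriv)
    have e: "\<alpha>^2 * (\<phi> x - C1) * (deriv \<phi> x)^2 = - (A (\<theta> x) * (a * s x)^2)" for x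
    proof -
      have "\<alpha>^2 * (\<phi> x - C1) * (deriv \<phi> x)^2 = (\<alpha>^2 * (w x)^2) * (- B (\<theta> x)) * (a * s x)^2"
        unfolding deriv1 by (simp add: B_def \<phi>_def power_mult_distrib)
      also have "\<dots> = - (A (\<theta> x) * (a * s x)^2)"
        unfolding w2 using B[of "\<theta> x"] by simp
      finally show ?thesis .
    qed
    have s2: "(s x)^2 = 1 - (c x)^2" for x by (simp add: s_def c_def sin_squared_eq)
    have E2: "\<alpha>^2 * (\<phi> x - C1) * (deriv \<phi> x)^2 + (C1 - C2) * (\<phi> x)^2 - (\<phi> x)^3
            - 2*b*\<phi> x + C1 * (2*b + C1*C2) = C3" for x
    proof -
      have "- (A (\<theta> x) * (a * s x)^2) = (\<phi> x - r0) * ((\<phi> x - m)^2 - a^2)"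
        unfolding power_mult_distrib s2 by (simp add: A_def \<phi>_def c_def algebra_simps power2_eq_square)
      with e[of x] R[of "\<phi> x"] show ?thesis by simp
    qed
    \<comment> \<open>The factorization \<open>R\<close> holds for all \<open>p\<close>, so it may
      be differentiated; half of the result closes (E1).\<close>
    have cubic': "- (2 * (C1 - C2) * p - 3 * p^2 - 2 * b) = (p - m)^2 - a^2 + (p - r0) * (2 * (p - m))" for p
    proof -
      have "((\<lambda>p. C3 - ((C1 - C2) * p^2 - p^3 - 2 * b * p + C1 * (2 * b + C1 * C2)))
        has_real_derivative - (2 * (C1 - C2) * p - 3 * p^2 - 2 * b)) (at p)"
        by (auto intro!: derivative_eq_intros simp: power2_eq_square)
      moreover have "((\<lambda>p. (p - r0) * ((p - m)^2 - a^2)) has_real_derivative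
        (p - m)^2 - a^2 + (p - r0) * (2 * (p - m))) (at p)"
        by (auto intro!: derivative_eq_intros)
      ultimately show ?thesis unfolding R by (rule DERIV_unique)
    qed
    have E1: "\<alpha>^2 * (\<phi> x - C1) * deriv (deriv \<phi>) x + (1/2) * \<alpha>^2 * (deriv \<phi> x)^2
            + (C1 - C2 - (3/2) * \<phi> x) * \<phi> x = b" for x
    proof -
      have Bq: "B (\<theta> x) * q x = 1" using B[of "\<theta> x"] by (simp add: q_def)
      have AqBq: "A (\<theta> x) * q x + B (\<theta> x) * q x = (C1 - r0) * q x"
        unfolding AB[of "\<theta> x", symmetric] by (simp add: distrib_right)
      have k: "\<alpha>^2 * k = - (a * (C1 - r0)) / 2" using \<alpha> by (simp add: k_def)
      have w2': "\<alpha>^2 * (w x)^2 = A (\<theta> x) * q x" unfolding w2 q_def by (simp add: divide_inverse)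
      have "\<alpha>^2 * (\<phi> x - C1) * deriv (deriv \<phi>) x =
         (\<alpha>^2 * (w x)^2) * B (\<theta> x) * (a * c x) + (\<alpha>^2 * k) * a * (s x)^2 * (B (\<theta> x) * q x) * q x"
        unfolding deriv2 by (simp add: B_def \<phi>_def algebra_simps power2_eq_square)
      also have "\<dots> = A (\<theta> x) * (B (\<theta> x) * q x) * (a * c x) - (a * s x)^2 / 2 * (C1 - r0) * (B (\<theta> x) * q x) * q x"
        unfolding w2' k by (simp add: field_simps power2_eq_square)
      \<comment> \<open>Splitting \<open>C1 - r0\<close> as \<open>A + B\<close> isolates a term in
        \<open>A * q\<close> that cancels the squared derivative in (E1).\<close>
      also have "\<dots> = A (\<theta> x) * (a * c x) - (a * s x)^2 / 2 * (A (\<theta> x) * q x + B (\<theta> x) * q x)"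
        unfolding AqBq unfolding Bq by simp
      also have "\<dots> = A (\<theta> x) * (a * c x) - (a * s x)^2 / 2 * (A (\<theta> x) * q x) - (a * s x)^2 / 2"
        unfolding Bq by (simp add: algebra_simps)
      finally have 1: "\<alpha>^2 * (\<phi> x - C1) * deriv (deriv \<phi>) x = \<dots>" .
      have 2: "(1/2) * \<alpha>^2 * (deriv \<phi> x)^2 = (a * s x)^2 / 2 * (A (\<theta> x) * q x)"
        unfolding deriv1 w2'[symmetric] by (simp add: power_mult_distrib)
      have "A (\<theta> x) * (a * c x) = (\<phi> x - r0) * (\<phi> x - m)"
        by (simp add: A_def \<phi>_def c_def)
      moreover have "(a * s x)^2 = a^2 - (\<phi> x - m)^2"
        unfolding power_mult_distrib s2 by (simp add: \<phi>_def c_def algebra_simps power2_eq_square)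
      ultimately show ?thesis
        unfolding 1 2 using cubic'[of "\<phi> x"] by (simp add: field_simps power2_eq_square)
    qed
    show ?thesis unfolding TW_solution_def using E1 E2 by blast
  qed
  ultimately show ?thesis by blast
qed

section \<open>From the potential to the three roots\<close>

lemma monic_cubic_third_root:
  fixes e f k r1 r2 :: real
  assumes "r1 \<noteq> r2" "r1^3 + e * r1^2 + f * r1 + k = 0" "r2^3 + e * r2^2 + f * r2 + k = 0"
  shows "p^3 + e * p^2 + f * p + k = (p + e + r1 + r2) * ((p - r1) * (p - r2))"
proof -
  \<comment> \<open>Subtracting the two root equations and dividing by \<open>r1 - r2\<close>
    determines \<open>f\<close>; either equation then determines \<open>k\<close>.\<close>
  have "(r1 - r2) * (r1^2 + r1 * r2 + r2^2 + e * (r1 + r2) + f) = 0"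
    using assms(2,3) by (simp add: algebra_simps power2_eq_square power3_eq_cube)
  then have f: "f = - (r1^2 + r1 * r2 + r2^2 + e * (r1 + r2))" using assms(1) by simp
  have k: "k = - (r1^3 + e * r1^2 + f * r1)" using assms(2) by simp
  show ?thesis unfolding k f by (simp add: algebra_simps power2_eq_square power3_eq_cube)
qed

text \<open>Left of \<open>C1\<close>, the sign of the cubic \<open>R\<close> is that of
  \<open>U - b\<close>, while \<open>R C1 = C3 > 0\<close>. The sign pattern plus, minus, plus at
  \<open>p1\<close>, \<open>p2\<close>, \<open>C1\<close> yields \<open>r1\<close> and
  \<open>r2\<close>.\<close>

lemma TW_solution_exists:
  fixes \<alpha> C1 C2 C3 b p1 p2 :: real
  assumes \<alpha>: "\<alpha> > 0" and C3: "C3 > 0" and p: "p1 < p2" "p2 < C1"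
    and U1: "b < U C1 C2 C3 p1" and U2: "U C1 C2 C3 p2 < b"
  shows "\<exists>\<phi>. smooth_fun \<phi> \<and> periodic_fun \<phi> \<and> \<not> (\<exists>c. \<forall>\<xi>. \<phi> \<xi> = c) \<and> TW_solution \<alpha> C1 C2 b C3 \<phi>"
proof -
  define R where "R = (\<lambda>p. C3 - ((C1 - C2) * p^2 - p^3 - 2 * b * p + C1 * (2 * b + C1 * C2)))"
  have R: "R p = 2 * (C1 - p) * (U C1 C2 C3 p - b)" if "p < C1" for p
  proof -
    define v where "v = C3 / (2 * (p - C1))"
    have "C3 = 2 * (p - C1) * v" using that by (simp add: v_def)
    then show ?thesis
      unfolding R_def U_def v_def[symmetric]
      by (simp add: algebra_simps power2_eq_square power3_eq_cube)
  qed
  have Rs: "R p1 > 0" "R p2 < 0" "R C1 > 0"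
    using p U1 U2 C3 by (auto simp: R mult_pos_neg) (simp add: R_def algebra_simps power2_eq_square power3_eq_cube)
  have cont: "continuous_on S R" for S unfolding R_def by (intro continuous_intros)
  obtain r1 where r1: "p1 \<le> r1" "r1 \<le> p2" "R r1 = 0"
    using IVT2'[of R p2 0 p1] Rs p cont by auto
  obtain r2 where r2: "p2 \<le> r2" "r2 \<le> C1" "R r2 = 0"
    using IVT'[of R p2 0 C1] Rs p cont by auto
  have strict: "p1 < r1" "r1 < p2" "p2 < r2" "r2 < C1"
    using r1 r2 Rs by (auto simp: less_le)
  have Rp: "R p = p^3 + (- (C1 - C2)) * p^2 + 2 * b * p + (C3 - C1 * (2 * b + C1 * C2))" for p
    by (simp add: R_def algebra_simps)
  define r0 where "r0 = C1 - C2 - r1 - r2"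
  have fac: "R p = (p - r0) * ((p - r1) * (p - r2))" for p
    using monic_cubic_third_root[of r1 r2 "- (C1 - C2)" "2 * b" "C3 - C1 * (2 * b + C1 * C2)" p]
      r1(3) r2(3) strict unfolding Rp r0_def by (simp add: algebra_simps)
  \<comment> \<open>With \<open>R p1 > 0\<close> this forces \<open>r0 < p1\<close>, so the third
    root lies below the other two.\<close>
  have "(p1 - r1) * (p1 - r2) > 0" using strict by (intro mult_neg_neg) auto
  then have "r0 < r1" using zero_less_mult_pos2[OF Rs(1)[unfolded fac]] strict by simp
  define m a where "m = (r1 + r2) / 2" and "a = (r2 - r1) / 2"
  have "(p - r1) * (p - r2) = (p - m)^2 - a^2" for p
    by (simp add: m_def a_def field_simps power2_eq_square)
  with fac have "R p = (p - r0) * ((p - m)^2 - a^2)" for p by simp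
  then show ?thesis
    using \<open>r0 < r1\<close> strict \<alpha> unfolding R_def
    by (intro TW_solution_of_roots[where ?r0.0 = r0 and m = m and a = a]) (auto simp: m_def a_def field_simps)
qed

subsection \<open>The existence region\<close>

lemma C1_on_continuous: "C1_on S f \<Longrightarrow> continuous_on S f"
  unfolding C1_on_def by (meson DERIV_isCont continuous_at_imp_continuous_on)

theorem theorem1:
  fixes \<alpha> C1 C2 :: real
  assumes "\<alpha> > 0" and "2*C1 + C2 > 0"
  shows
    "C1_on {0<..<C3crit C1 C2} (b_minus C1 C2)
   \<and> strict_mono_on {0<..<C3crit C1 C2} (b_minus C1 C2)
   \<and> (b_minus C1 C2 \<longlongrightarrow> - (1/2)*C1^2 - C1*C2) (at_right 0)
   \<and> (b_minus C1 C2 \<longlongrightarrow> (1/6)*(C1 - C2)^2) (at_left (C3crit C1 C2))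
   \<and> C1_on {0<..<C3crit C1 C2} (b_plus C1 C2)
   \<and> strict_mono_on {0<..<C3crit C1 C2} (b_plus C1 C2)
   \<and> (b_plus C1 C2 \<longlongrightarrow> (1/8)*(C2^2 - 4*C1*C2)) (at_right 0)
   \<and> (b_plus C1 C2 \<longlongrightarrow> (1/6)*(C1 - C2)^2) (at_left (C3crit C1 C2))
   \<and> C1_on {- (1/2)*C1^2 - C1*C2 <..< (1/6)*(C1 - C2)^2} (C3_minus C1 C2)
   \<and> C1_on {(1/8)*(C2^2 - 4*C1*C2) <..< (1/6)*(C1 - C2)^2} (C3_plus C1 C2)
   \<and> open (region C1 C2)
   \<and> simply_connected (region C1 C2)
   \<and> region C1 C2 =
       {(C3, b). - (1/2)*C1^2 - C1*C2 < b \<and> b < (1/6)*(C1 - C2)^2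
          \<and> (if b \<le> (1/8)*(C2^2 - 4*C1*C2) then 0 else C3_plus C1 C2 b) < C3
          \<and> C3 < C3_minus C1 C2 b}
   \<and> (\<forall>C3 b. (C3, b) \<in> region C1 C2 \<longrightarrow>
        (\<exists>\<phi>. smooth_fun \<phi> \<and> periodic_fun \<phi> \<and> \<not> (\<exists>c. \<forall>\<xi>. \<phi> \<xi> = c)
             \<and> TW_solution \<alpha> C1 C2 b C3 \<phi>))"
proof -
  define h M where "h = (2*C1 + C2)/6" and "M = (C1 - C2)^2/6"
  \<comment> \<open>The values of \<open>M - 3/2 * r^2\<close> at the two ends
    \<open>r = 2 * h\<close> and \<open>r = h\<close>, both of which correspond to
    \<open>C3 = 0\<close>.\<close>
  define lm lp where "lm = M - 3/2 * (2*h)^2" and "lp = M - 3/2 * h^2"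
  have h: "h > 0" using assms(2) by (simp add: h_def)
  have ends: "- (1/2)*C1^2 - C1*C2 = lm" "(1/8)*(C2^2 - 4*C1*C2) = lp" "(1/6)*(C1 - C2)^2 = M"
    by (simp_all add: lm_def lp_def h_def M_def field_simps power2_eq_square)
  have crit: "C3crit C1 C2 = 8 * h^3"
    by (simp add: C3crit_def h_def field_simps power3_eq_cube)
  interpret minus: increasing_branch "branch h M 1" "\<lambda>b. 2 * (2*h - 1 * sqrt (2/3 * (M - b)))" "b_minus C1 C2" lm M
    unfolding lm_def by (rule b_minus_branch[OF h_def h M_def])
  interpret plus: increasing_branch "branch h M (-1)" "\<lambda>b. 2 * (2*h - (-1) * sqrt (2/3 * (M - b)))" "b_plus C1 C2" lp M
    unfolding lp_def by (rule b_plus_branch[OF h_def h M_def])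
  have M: "branch h M \<sigma> M = C3crit C1 C2" for \<sigma>
    using branch_eq[of 0 h M \<sigma>] by (simp add: crit)
  have lm: "branch h M 1 lm = 0"
    unfolding lm_def using h by (subst branch_eq) (auto simp: power2_eq_square power3_eq_cube)
  have lp: "branch h M (-1) lp = 0"
    unfolding lp_def using h by (subst branch_eq) (auto simp: power2_eq_square power3_eq_cube)
  note [simp] = M lm lp
  let ?I = "{0<..<C3crit C1 C2}"
  have "lm < lp" using h by (simp add: lm_def lp_def)
  \<comment> \<open>At \<open>b = b_plus C1 C2 y\<close> the lower branch equals \<open>y\<close>,
    so the upper branch exceeds \<open>y\<close>; monotonicity of the upper branch then gives the
    claim.\<close>
  have b_less: "b_minus C1 C2 y < b_plus C1 C2 y" if y: "y \<in> ?I" for y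
    using branch_less[of "b_plus C1 C2 y" M h] plus.g_in[of y] plus.right_inverse[of y] y
      minus.g_less_iff[of "b_plus C1 C2 y" y] \<open>lm < lp\<close> by auto
  have region: "region C1 C2 = {(y, b). y \<in> ?I \<and> b_minus C1 C2 y < b \<and> b < b_plus C1 C2 y}"
    unfolding region_def by auto
  have cm: "continuous_on ?I (b_minus C1 C2)" and cp: "continuous_on ?I (b_plus C1 C2)"
    using minus.C1_on_g plus.C1_on_g C1_on_continuous by simp_all
  have C3m: "C3_minus C1 C2 b = branch h M 1 b" if "b \<in> {lm<..<M}" for b
    using minus.inv_into_eq[OF that] by (simp add: C3_minus_def)
  have C3p: "C3_plus C1 C2 b = branch h M (-1) b" if "b \<in> {lp<..<M}" for b
    using plus.inv_into_eq[OF that] by (simp add: C3_plus_def)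
  \<comment> \<open>Each bound on \<open>b\<close> is turned into a bound on \<open>y\<close> by
    applying the increasing branch. For \<open>b \<le> lp\<close> the bound by \<open>b_plus\<close>
    holds automatically, so the boundary is \<open>C3 = 0\<close>.\<close>
  have mem: "(y \<in> ?I \<and> b_minus C1 C2 y < b \<and> b < b_plus C1 C2 y) \<longleftrightarrow>
     (lm < b \<and> b < M \<and> (if b \<le> lp then 0 else C3_plus C1 C2 b) < y \<and> y < C3_minus C1 C2 b)"
    (is "?L \<longleftrightarrow> ?R") for y b
  proof
    assume L: ?L
    then have b: "lm < b" "b < M"
      using minus.g_in[of y] plus.g_in[of y] by auto
    moreover have "y < C3_minus C1 C2 b"
      using L b minus.g_less_iff[of b y] C3m[of b] by auto
    moreover have "C3_plus C1 C2 b < y" if "\<not> b \<le> lp"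
      using L b that plus.less_g_iff[of b y] C3p[of b] by auto
    ultimately show ?R using L by auto
  next
    assume R: ?R
    then have b: "b \<in> {lm<..<M}" by simp
    have y: "y < C3_minus C1 C2 b" using R by simp
    also have "\<dots> < C3crit C1 C2" using minus.G_in[OF b] C3m[OF b] by simp
    finally have "y < C3crit C1 C2" .
    moreover have "0 < y"
      using R C3p[of b] plus.G_in[of b] by (auto split: if_splits)
    ultimately have yI: "y \<in> ?I" by simp
    moreover have "b_minus C1 C2 y < b"
      using y yI b minus.g_less_iff[of b y] C3m[of b] by auto
    moreover have "b < b_plus C1 C2 y"
    proof (cases "b \<le> lp")
      case True
      then show ?thesis using plus.g_in[of y] yI by auto
    next
      case False
      then show ?thesis using R yI plus.less_g_iff[of b y] C3p[of b] by auto
    qed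
    ultimately show ?L by blast
  qed
  have solution: "\<exists>\<phi>. smooth_fun \<phi> \<and> periodic_fun \<phi> \<and> \<not> (\<exists>c. \<forall>\<xi>. \<phi> \<xi> = c) \<and> TW_solution \<alpha> C1 C2 b y \<phi>"
    if "(y, b) \<in> region C1 C2" for y b
  proof -
    have y: "y \<in> ?I" "U C1 C2 y (phi2 C1 C2 y) < b" "b < U C1 C2 y (phi1 C1 C2 y)"
      using that by (auto simp: region b_minus_def b_plus_def)
    \<comment> \<open>Every admissible \<open>y\<close> is a value of the branch at some amplitude
      \<open>r\<close>, so the explicit formula for the root applies.\<close>
    have "(C1 - C2)/3 < phi2 C1 C2 y" "phi2 C1 C2 y < C1"
    proof -
      obtain x where x: "x \<in> {lm<..<M}" "branch h M 1 x = y"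
        using y(1) minus.inverse_obtains[of y] by auto
      have "2 * h > 0" using h by simp
      obtain r where r: "0 < r" "r < 2 * h" "x = M - 3/2 * r^2"
        using x(1)[unfolded lm_def] \<open>2 * h > 0\<close> by (rule amplitude_obtains)
      then have "phi2 C1 C2 y = (C1 - C2)/3 + r"
        using phi2_eq[OF h_def r(1,2)] x(2) branch_eq[of r h M 1] by simp
      then show "(C1 - C2)/3 < phi2 C1 C2 y" "phi2 C1 C2 y < C1"
        using r by (simp_all add: h_def field_simps)
    qed
    moreover have "phi1 C1 C2 y < (C1 - C2)/3"
    proof -
      obtain x where x: "x \<in> {lp<..<M}" "branch h M (-1) x = y"
        using y(1) plus.inverse_obtains[of y] by auto
      obtain r where r: "0 < r" "r < h" "x = M - 3/2 * r^2"
        using x(1) h unfolding lp_def by (rule amplitude_obtains)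
      then have "phi1 C1 C2 y = (C1 - C2)/3 + - r"
        using phi1_eq[OF h_def, of "- r"] x(2) branch_eq[of r h M "-1"] by simp
      then show ?thesis
        using r by (simp add: field_simps)
    qed
    ultimately show ?thesis
      using TW_solution_exists[of \<alpha> y "phi1 C1 C2 y" "phi2 C1 C2 y" C1 b C2] y assms(1) by auto
  qed
  show ?thesis
    unfolding ends using solution
  proof (intro conjI; (intro allI impI; blast)?)
    show "C1_on ?I (b_minus C1 C2)" "C1_on ?I (b_plus C1 C2)"
      using minus.C1_on_g plus.C1_on_g by simp_all
    show "strict_mono_on ?I (b_minus C1 C2)" "strict_mono_on ?I (b_plus C1 C2)"
      using minus.g_strict_mono plus.g_strict_mono by simp_all
    show "(b_minus C1 C2 \<longlongrightarrow> lm) (at_right 0)" "(b_plus C1 C2 \<longlongrightarrow> lp) (at_right 0)"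
      using minus.tendsto_left_end plus.tendsto_left_end by simp_all
    show "(b_minus C1 C2 \<longlongrightarrow> M) (at_left (C3crit C1 C2))" "(b_plus C1 C2 \<longlongrightarrow> M) (at_left (C3crit C1 C2))"
      using minus.tendsto_right_end plus.tendsto_right_end by simp_all
    show "C1_on {lm<..<M} (C3_minus C1 C2)" "C1_on {lp<..<M} (C3_plus C1 C2)"
      using minus.C1_on_inv_into plus.C1_on_inv_into by (simp_all add: C3_minus_def C3_plus_def)
    show "open (region C1 C2)"
      unfolding region using cm cp by (rule open_between_graphs) simp
    show "simply_connected (region C1 C2)"
      unfolding region using cm cp b_less by (intro simply_connected_between_graphs) auto
    show "region C1 C2 = {(y, b). lm < b \<and> b < M \<and> (if b \<le> lp then 0 else C3_plus C1 C2 b) < y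
        \<and> y < C3_minus C1 C2 b}"
      unfolding region mem ..
  qed
qed

end
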